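(* Let $(s_n)_{n\ge 0}$ be a sequence of positive integers with $s_0=1$. Suppose there exist positive integers $z_n$ ($n\ge 1$) such that $z_1=s_1$ and, for all $n\ge 2$, $$s_n = z_n+\sum_{i=1}^{n-1} z_i\, s_{n-i}.$$ Then there exists a sequence $(G_n)_{n\ge 0}$ of generalized action graphs for the sequence $(s_n)_{n\ge 0}$ such that, for all $n$ and all $i$ with $1\le i\le n$, $z_i$ is the number of vertices of $G_n$ labeled $i$ that are adjacent to the root (the vertex labeled $0$).
   Context: A sequence $(G_n)_{n\ge 0}$ of generalized action graphs for a sequence $(s_n)_{n\ge 0}$ of positive integers with $s_0=1$ is a sequence of finite directed graphs whose vertices are labeled by non-negative integers, each $G_n$ being a rooted tree with all edges directed away from the root, satisfying the following three axioms. Axiom 1: $G_0$ is the graph with $s_0$ vertices labeled $0$ and no edges (so, since $s_0=1$, $G_0$ is a single vertex labeled $0$, which is the root of every $G_n$). For $n\ge 1$, $G_n$ is constructed from $G_{n-1}$ by adding exactly $s_n$ new vertices, each labeled $n$, each new vertex being attached by an edge from a vertex of $G_{n-1}$ to it; the vertices, labels and edges of $G_{n-1}$ are kept unchanged. Axiom 2: For every vertex $v$ of $G_n$, the subtree of $G_n$ with root $v$ (the subgraph consisting of $v$ and all vertices reachable from $v$ by directed paths, with all edges among them) is isomorphic to $G_k$ for some $k\le n$. Here isomorphism means isomorphism of the underlying directed graphs; labels are not required to agree (they may be shifted). Axiom 3: All leaves of $G_n$ (vertices with no outgoing edges) have label $n$. *)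

theory Defs
  imports "Graph_Theory.Graph_Theory"
begin

text \<open>
  A finite rooted tree whose arcs all point away from the root: every vertex is the end of
  exactly one directed walk starting at the root. This excludes loops, cycles and vertices of
  in-degree greater than one; representing arcs as pairs of vertices excludes parallel arcs.
\<close>

locale out_tree = pair_fin_digraph T for T :: "'a pair_pre_digraph" +
  fixes r :: 'a
  assumes root_in_verts: "r \<in> pverts T"
    and unique_awalk: "v \<in> pverts T \<Longrightarrow> \<exists>!p. awalk r p v"

text \<open>
  The subtree at a vertex carries no labels here, and \<^const>\<open>digraph_iso\<close> does not mention the
  labelling, so labels may be shifted by the isomorphism.
\<close>

definition subtree_at :: "'a pair_pre_digraph \<Rightarrow> 'a \<Rightarrow> ('a, 'a \<times> 'a) pre_digraph" where
  "subtree_at T v = with_proj T \<restriction> {w. v \<rightarrow>\<^sup>*\<^bsub>with_proj T\<^esub> w}"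

text \<open>
  \<open>label n v\<close> is the label of \<open>v\<close> as a vertex of \<open>G n\<close>; its value is irrelevant when \<open>v\<close> is not
  a vertex of \<open>G n\<close>. The vertex \<open>r\<close> is the common root of all the graphs.
  In \<open>step_arcs\<close>, \<open>parent v\<close> is the vertex to which the new vertex \<open>v\<close> is attached; the equation
  says that the old arcs are kept and that nothing but one arc per new vertex is added.
\<close>

locale generalized_action_graphs =
  fixes s :: "nat \<Rightarrow> nat"
    and G :: "nat \<Rightarrow> 'a pair_pre_digraph"
    and label :: "nat \<Rightarrow> 'a \<Rightarrow> nat"
    and r :: 'a
  assumes s_pos: "s n > 0"
    and s_0: "s 0 = 1"
    and out_tree: "out_tree (G n) r"
    and init_verts: "card (pverts (G 0)) = s 0"
    and init_label: "v \<in> pverts (G 0) \<Longrightarrow> label 0 v = 0"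
    and init_arcs: "parcs (G 0) = {}"
    and step_old_verts: "pverts (G n) \<subseteq> pverts (G (Suc n))"
    and step_old_label: "v \<in> pverts (G n) \<Longrightarrow> label (Suc n) v = label n v"
    and step_new_verts: "card (pverts (G (Suc n)) - pverts (G n)) = s (Suc n)"
    and step_new_label: "v \<in> pverts (G (Suc n)) - pverts (G n) \<Longrightarrow> label (Suc n) v = Suc n"
    and step_arcs: "\<exists>parent. (\<forall>v \<in> pverts (G (Suc n)) - pverts (G n). parent v \<in> pverts (G n)) \<and>
      parcs (G (Suc n)) =
        parcs (G n) \<union> (\<lambda>v. (parent v, v)) ` (pverts (G (Suc n)) - pverts (G n))"
    and subtree_iso: "v \<in> pverts (G n) \<Longrightarrow> \<exists>k\<le>n. digraph_iso (subtree_at (G n) v) (with_proj (G k))"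
    and leaf_label: "v \<in> pverts (G n) \<Longrightarrow> out_arcs (with_proj (G n)) v = {} \<Longrightarrow> label n v = n"

end

theory Submission
  imports Defs "HOL-Library.Countable"
begin

text \<open>
  The tree is built explicitly. A coloured composition is a finite sequence of positive
  integers (its parts) in which a part of size \<open>i\<close> carries one of \<open>z i\<close> colours; its weight is
  the sum of its parts. The vertices of the graph \<open>G n\<close> are the coloured compositions of weight
  at most \<open>n\<close>, the root is the empty one, the children of a composition are its extensions by
  one more part, and the label of a vertex is its weight. All the requirements can be read off:

  \<^item> Splitting off one part shows that the number of coloured compositions of weight
    \<open>n \<ge> 1\<close> satisfies \<open>c n = (\<Sum>i = 1..n. z i * c (n - i))\<close> with \<open>c 0 = 1\<close>. This is the recursion
    assumed of \<open>s\<close>, with its first summand \<open>z n\<close> read as \<open>z n * s 0\<close>. Hence \<open>c = s\<close>, and exactly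
    \<open>s n\<close> vertices are new in \<open>G n\<close> (\<open>card_compositions_of\<close>).
  \<^item> As parts are positive, the parent of a new vertex has smaller weight, so it is old.
  \<^item> The vertices below a composition \<open>ys\<close> in \<open>G n\<close> are the extensions of \<open>ys\<close> by a coloured
    composition of weight at most \<open>n - weight ys\<close>, so that the subtree at \<open>ys\<close> is a copy of
    \<open>G (n - weight ys)\<close> (\<open>subtree_iso_tree\<close>).
  \<^item> A vertex of weight \<open>k < n\<close> can be extended by a part of size \<open>n - k\<close>, because
    \<open>z (n - k) > 0\<close>; so it is not a leaf of \<open>G n\<close> (\<open>out_arcs_tree_nonempty\<close>).
  \<^item> The children of the root with label \<open>i\<close> are the compositions with the single part \<open>i\<close>, one
    for each colour.

  Any injective encoding of coloured compositions turns them into vertices of the required type.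
\<close>

section \<open>Coloured compositions\<close>

text \<open>
  A pair \<open>(i, c)\<close> is a part of size \<open>i\<close> and colour \<open>c\<close>. Lists grow at the head, so the most
  recently added part comes first and the parent of a vertex is the tail of its list.
\<close>

definition weight :: "(nat \<times> nat) list \<Rightarrow> nat" where
  "weight xs = sum_list (map fst xs)"

lemma weight_simps [simp]:
  "weight [] = 0"
  "weight (x # xs) = fst x + weight xs"
  "weight (xs @ ys) = weight xs + weight ys"
  by (simp_all add: weight_def)

definition compositions :: "(nat \<Rightarrow> nat) \<Rightarrow> (nat \<times> nat) list set" where
  "compositions z = lists (SIGMA i:{1..}. {..<z i})"

lemma Nil_in_compositions [simp]: "[] \<in> compositions z"
  by (simp add: compositions_def)

lemma Cons_in_compositions_iff [simp]:
  "(i, c) # xs \<in> compositions z \<longleftrightarrow> 1 \<le> i \<and> c < z i \<and> xs \<in> compositions z"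
  by (auto simp: compositions_def)

lemma append_in_compositions_iff [simp]:
  "xs @ ys \<in> compositions z \<longleftrightarrow> xs \<in> compositions z \<and> ys \<in> compositions z"
  by (simp add: compositions_def)

definition compositions_of :: "(nat \<Rightarrow> nat) \<Rightarrow> nat \<Rightarrow> (nat \<times> nat) list set" where
  "compositions_of z n = {xs \<in> compositions z. weight xs = n}"

lemma compositions_of_0: "compositions_of z 0 = {[]}"
proof -
  have "xs = []" if "xs \<in> compositions z" "weight xs = 0" for xs
    using that by (cases xs) auto
  then show ?thesis by (auto simp: compositions_of_def)
qed

text \<open>The combinatorial content of the recursion: a nonempty composition has a unique head.\<close>

lemma bij_betw_compositions_of:
  assumes "n \<ge> 1"
  shows "bij_betw (\<lambda>(i, c, xs). (i, c) # xs)
    (SIGMA i:{1..n}. {..<z i} \<times> compositions_of z (n - i)) (compositions_of z n)"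
proof (rule bij_betw_imageI)
  show "inj_on (\<lambda>(i, c, xs). (i, c) # xs) (SIGMA i:{1..n}. {..<z i} \<times> compositions_of z (n - i))"
    by (auto simp: inj_on_def)
  show "(\<lambda>(i, c, xs). (i, c) # xs) ` (SIGMA i:{1..n}. {..<z i} \<times> compositions_of z (n - i))
    = compositions_of z n" (is "?f ` ?S = _")
  proof
    show "?f ` ?S \<subseteq> compositions_of z n"
      by (auto simp: compositions_of_def)
    show "compositions_of z n \<subseteq> ?f ` ?S"
    proof
      fix ys assume ys: "ys \<in> compositions_of z n"
      then obtain i c xs where "ys = (i, c) # xs"
        using assms by (cases ys) (auto simp: compositions_of_def)
      with ys show "ys \<in> ?f ` ?S"
        by (intro image_eqI[where x = "(i, c, xs)"]) (auto simp: compositions_of_def)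
    qed
  qed
qed

lemma finite_compositions_of [simp]: "finite (compositions_of z n)"
proof (induction n rule: less_induct)
  case (less n)
  show ?case
  proof (cases "n = 0")
    case False
    then have "finite (SIGMA i:{1..n}. {..<z i} \<times> compositions_of z (n - i))"
      using less by (intro finite_SigmaI finite_cartesian_product) auto
    then show ?thesis
      using bij_betw_finite[OF bij_betw_compositions_of[of n z]] False by simp
  qed (simp add: compositions_of_0)
qed

lemma card_compositions_of_rec:
  assumes "n \<ge> 1"
  shows "card (compositions_of z n) = (\<Sum>i = 1..n. z i * card (compositions_of z (n - i)))"
  using bij_betw_same_card[OF bij_betw_compositions_of[OF assms, of z]]
  by (simp add: card_cartesian_product)

lemma card_compositions_of:
  assumes s_0: "s 0 = 1"
    and s_rec: "\<And>n. n \<ge> 1 \<Longrightarrow> s n = (\<Sum>i = 1..n. z i * s (n - i))"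
  shows "card (compositions_of z n) = s n"
proof (induction n rule: less_induct)
  case (less n)
  show ?case
  proof (cases "n = 0")
    case False
    then show ?thesis
      using less by (simp add: card_compositions_of_rec s_rec[of n])
  qed (simp add: compositions_of_0 s_0)
qed

section \<open>The tree of coloured compositions\<close>

text \<open>
  The encoding \<open>e\<close> names the vertices. It is a parameter because the statement asks for natural
  numbers as vertices, while the argument only uses that distinct lists have distinct names.
\<close>

locale composition_tree =
  fixes z :: "nat \<Rightarrow> nat" and e :: "(nat \<times> nat) list \<Rightarrow> 'a"
  assumes z_pos: "n \<ge> 1 \<Longrightarrow> z n > 0"
    and inj_e: "inj e"
begin

lemma e_eq_iff [simp]: "e xs = e ys \<longleftrightarrow> xs = ys"
  using inj_e by (auto dest: injD)

lemma inv_e [simp]: "inv e (e xs) = xs"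
  by (simp add: inj_e)

definition tree :: "nat \<Rightarrow> 'a pair_pre_digraph" where
  "tree n = \<lparr>pverts = e ` {xs \<in> compositions z. weight xs \<le> n},
     parcs = (\<lambda>(x, xs). (e xs, e (x # xs))) ` {(x, xs). x # xs \<in> compositions z \<and> weight (x # xs) \<le> n}\<rparr>"

lemma in_pverts_tree_iff [simp]:
  "e xs \<in> pverts (tree n) \<longleftrightarrow> xs \<in> compositions z \<and> weight xs \<le> n"
  by (auto simp: tree_def)

lemma pverts_treeE:
  assumes "v \<in> pverts (tree n)"
  obtains xs where "v = e xs" "xs \<in> compositions z" "weight xs \<le> n"
  using assms by (auto simp: tree_def)

lemma parcs_treeE:
  assumes "a \<in> parcs (tree n)"
  obtains i c xs where "a = (e xs, e ((i, c) # xs))" "1 \<le> i" "c < z i" "xs \<in> compositions z"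
    "i + weight xs \<le> n"
  using assms by (auto simp: tree_def)

lemma in_parcs_tree_iff [simp]:
  "(e xs, e ys) \<in> parcs (tree n) \<longleftrightarrow>
    (\<exists>x. ys = x # xs) \<and> ys \<in> compositions z \<and> weight ys \<le> n"
  by (auto simp: tree_def image_iff)

lemma pair_fin_digraph_tree: "pair_fin_digraph (tree n)"
proof
  show "fst a \<in> pverts (tree n)" if "a \<in> parcs (tree n)" for a
    using that by (auto elim: parcs_treeE)
  show "snd a \<in> pverts (tree n)" if "a \<in> parcs (tree n)" for a
    using that by (auto elim: parcs_treeE)
  have "pverts (tree n) = e ` (\<Union>k\<le>n. compositions_of z k)"
    by (auto simp: tree_def compositions_of_def)
  then show fin: "finite (pverts (tree n))"
    by simp
  have "parcs (tree n) \<subseteq> pverts (tree n) \<times> pverts (tree n)"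
    by (auto elim: parcs_treeE)
  then show "finite (parcs (tree n))"
    by (rule finite_subset) (simp add: fin)
qed

interpretation tree: pair_fin_digraph "tree n" for n
  by (rule pair_fin_digraph_tree)

primrec root_path :: "(nat \<times> nat) list \<Rightarrow> ('a \<times> 'a) list" where
  "root_path [] = []"
| "root_path (x # xs) = root_path xs @ [(e xs, e (x # xs))]"

text \<open>
  Walks from the root are unique because the last arc of a walk is determined by its end: the
  only arc into \<open>x # xs\<close> comes from \<open>xs\<close>, and no arc enters the root. This suggests an
  induction that removes the last arc.
\<close>

lemma awalk_tree_iff:
  "pre_digraph.awalk (with_proj (tree n)) (e []) p (e xs) \<longleftrightarrow>
    xs \<in> compositions z \<and> weight xs \<le> n \<and> p = root_path xs"
proof (induction p arbitrary: xs rule: rev_induct)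
  case Nil
  show ?case by (cases xs) (auto simp: tree.awalk_Nil_iff)
next
  case (snoc a p)
  show ?case
  proof (cases xs)
    case Nil
    then show ?thesis
      by (auto simp: tree.awalk_def elim: parcs_treeE)
  next
    case (Cons x ys)
    have "pre_digraph.awalk (with_proj (tree n)) (e []) (p @ [a]) (e (x # ys)) \<longleftrightarrow>
        a = (e ys, e (x # ys)) \<and> a \<in> parcs (tree n) \<and>
        pre_digraph.awalk (with_proj (tree n)) (e []) p (e ys)"
      by (auto simp: tree.awalk_simps tree.awalk_last_in_verts elim!: parcs_treeE)
    then show ?thesis
      using snoc[of ys] Cons by (cases x) auto
  qed
qed

lemma out_tree_tree: "out_tree (tree n) (e [])"
proof
  show "e [] \<in> pverts (tree n)" by simp
  fix v assume "v \<in> pverts (tree n)"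
  then show "\<exists>!p. tree.awalk n (e []) p v"
    by (auto simp: awalk_tree_iff elim!: pverts_treeE)
qed

lemma reachable_tree_iff:
  assumes "ys \<in> compositions z" "weight ys \<le> n"
  shows "e ys \<rightarrow>\<^sup>*\<^bsub>with_proj (tree n)\<^esub> w \<longleftrightarrow>
    (\<exists>xs. w = e (xs @ ys) \<and> xs \<in> compositions z \<and> weight xs \<le> n - weight ys)"
proof
  assume "e ys \<rightarrow>\<^sup>*\<^bsub>with_proj (tree n)\<^esub> w"
  then show "\<exists>xs. w = e (xs @ ys) \<and> xs \<in> compositions z \<and> weight xs \<le> n - weight ys"
  proof (induction rule: tree.reachable_induct)
    case base
    show ?case by (intro exI[of _ "[]"]) simp
  next
    case (step v w)
    then obtain xs where v: "v = e (xs @ ys)" by blast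
    with step.hyps(2) obtain x where "w = e (x # xs @ ys)"
      by (auto elim!: parcs_treeE)
    then show ?case
      using step.hyps(2) v by (intro exI[of _ "x # xs"]) (cases x; auto)
  qed
next
  assume "\<exists>xs. w = e (xs @ ys) \<and> xs \<in> compositions z \<and> weight xs \<le> n - weight ys"
  then obtain xs where "w = e (xs @ ys)" "xs \<in> compositions z" "weight xs \<le> n - weight ys"
    by blast
  then show "e ys \<rightarrow>\<^sup>*\<^bsub>with_proj (tree n)\<^esub> w"
  proof (induction xs arbitrary: w)
    case Nil
    then show ?case using assms by simp
  next
    case (Cons x xs)
    then have "e ys \<rightarrow>\<^sup>*\<^bsub>with_proj (tree n)\<^esub> e (xs @ ys)"
      by (cases x) auto
    moreover have "(e (xs @ ys), w) \<in> parcs (tree n)"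
      using Cons.prems assms by (cases x) auto
    ultimately show ?case by (rule tree.reachable_adj_trans)
  qed
qed

text \<open>
  Appending \<open>ys\<close> is the isomorphism. It is constructed from the smaller tree to the subtree,
  where it is defined everywhere, and then inverted.
\<close>

lemma subtree_iso_tree:
  assumes ys: "ys \<in> compositions z" "weight ys \<le> n"
  shows "digraph_iso (subtree_at (tree n) (e ys)) (with_proj (tree (n - weight ys)))"
proof -
  let ?k = "n - weight ys"
  define f where "f v = e (inv e v @ ys)" for v
  have f_e [simp]: "f (e xs) = e (xs @ ys)" for xs
    by (simp add: f_def)
  have inj_f: "inj_on f (pverts (tree ?k))"
    by (auto intro!: inj_onI elim!: pverts_treeE)
  define h where "h = \<lparr>iso_verts = f, iso_arcs = map_prod f f, iso_head = snd, iso_tail = fst\<rparr>"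
  have "inj_on (map_prod f f) (parcs (tree ?k))"
    by (auto intro!: inj_onI elim!: parcs_treeE)
  then have h: "tree.digraph_isomorphism ?k h"
    using inj_f tree.wf_digraph[of ?k] by (simp add: h_def tree.digraph_isomorphism_def)
  have reach: "{w. e ys \<rightarrow>\<^sup>*\<^bsub>with_proj (tree n)\<^esub> w} = f ` pverts (tree ?k)"
  proof -
    have "f ` pverts (tree ?k) = (\<lambda>xs. e (xs @ ys)) ` {xs \<in> compositions z. weight xs \<le> ?k}"
      by (simp add: tree_def image_image)
    then show ?thesis
      by (auto simp: reachable_tree_iff[OF ys])
  qed
  have "subtree_at (tree n) (e ys) = app_iso h (with_proj (tree ?k))"
  proof (rule pre_digraph.equality)
    show "verts (subtree_at (tree n) (e ys)) = verts (app_iso h (with_proj (tree ?k)))"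
      by (simp add: subtree_at_def h_def reach)
    show "arcs (subtree_at (tree n) (e ys)) = arcs (app_iso h (with_proj (tree ?k)))"
    proof
      show "arcs (subtree_at (tree n) (e ys)) \<subseteq> arcs (app_iso h (with_proj (tree ?k)))"
      proof
        fix a assume "a \<in> arcs (subtree_at (tree n) (e ys))"
        then have a: "a \<in> parcs (tree n)" and "fst a \<in> f ` pverts (tree ?k)"
          by (simp_all add: subtree_at_def reach)
        then obtain xs where xs: "fst a = f (e xs)"
          by (auto elim!: pverts_treeE)
        with a obtain x where "a = map_prod f f (e xs, e (x # xs))" "x # xs @ ys \<in> compositions z"
            "weight (x # xs @ ys) \<le> n"
          by (auto elim!: parcs_treeE)
        \<comment> \<open>The bound on the weight of \<open>x # xs @ ys\<close> puts the shortened arc into the smaller tree.\<close>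
        moreover from this have "(e xs, e (x # xs)) \<in> parcs (tree ?k)"
          by (cases x) auto
        ultimately show "a \<in> arcs (app_iso h (with_proj (tree ?k)))"
          unfolding h_def by (simp only: app_iso_simps digraph_isomorphism.simps with_proj_simps imageI)
      qed
      show "arcs (app_iso h (with_proj (tree ?k))) \<subseteq> arcs (subtree_at (tree n) (e ys))"
      proof
        fix a assume "a \<in> arcs (app_iso h (with_proj (tree ?k)))"
        then obtain b where a: "a = map_prod f f b" and b: "b \<in> parcs (tree ?k)"
          by (auto simp: h_def)
        from b have "fst b \<in> pverts (tree ?k)" "snd b \<in> pverts (tree ?k)"
          by (auto dest: tree.arc_fst_in_verts tree.arc_snd_in_verts)
        moreover from b have "map_prod f f b \<in> parcs (tree n)"
          using ys by (elim parcs_treeE) auto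
        ultimately show "a \<in> arcs (subtree_at (tree n) (e ys))"
          by (simp add: a subtree_at_def reach)
      qed
    qed
  qed (simp_all add: subtree_at_def h_def)
  with h have "digraph_iso (with_proj (tree ?k)) (subtree_at (tree n) (e ys))"
    unfolding digraph_iso_def by blast
  then show ?thesis
    by (rule digraph_iso_swap[OF tree.wf_digraph])
qed

lemma out_arcs_tree_nonempty:
  assumes "xs \<in> compositions z" "weight xs < n"
  shows "out_arcs (with_proj (tree n)) (e xs) \<noteq> {}"
proof -
  have "(e xs, e ((n - weight xs, 0) # xs)) \<in> out_arcs (with_proj (tree n)) (e xs)"
    using assms z_pos[of "n - weight xs"] by simp
  then show ?thesis by blast
qed

definition label :: "'a \<Rightarrow> nat" where
  "label v = weight (inv e v)"

lemma label_e [simp]: "label (e xs) = weight xs"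
  by (simp add: label_def)

lemma new_verts_tree: "pverts (tree (Suc n)) - pverts (tree n) = e ` compositions_of z (Suc n)"
  by (auto simp: compositions_of_def elim!: pverts_treeE)

lemma card_image_e: "card (e ` A) = card A"
  by (rule card_image) (simp add: inj_on_def)

text \<open>
  Removing the head of the list is thus a parent function as in the growth axiom. The arcs whose
  end has weight exactly \<open>Suc n\<close> are the new ones.
\<close>

lemma parcs_tree_Suc:
  "parcs (tree (Suc n)) =
    parcs (tree n) \<union> (\<lambda>v. (e (tl (inv e v)), v)) ` (pverts (tree (Suc n)) - pverts (tree n))" (is "?A = ?B")
proof
  show "?A \<subseteq> ?B"
  proof
    fix a assume "a \<in> ?A"
    then obtain i c xs where a: "a = (e xs, e ((i, c) # xs))" "1 \<le> i" "c < z i"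
        "xs \<in> compositions z" "i + weight xs \<le> Suc n"
      by (rule parcs_treeE)
    show "a \<in> ?B"
    proof (cases "i + weight xs = Suc n")
      case True
      then have "e ((i, c) # xs) \<in> pverts (tree (Suc n)) - pverts (tree n)"
        using a by simp
      then show ?thesis
        using a by (intro UnI2 image_eqI[where x = "e ((i, c) # xs)"]) simp_all
    qed (use a in simp)
  qed
  have "(e (tl (inv e v)), v) \<in> ?A" if "v \<in> pverts (tree (Suc n)) - pverts (tree n)" for v
  proof -
    from that obtain xs where "v = e xs" "xs \<in> compositions z" "weight xs = Suc n"
      by (auto simp: new_verts_tree compositions_of_def)
    then show ?thesis by (cases xs) auto
  qed
  moreover have "parcs (tree n) \<subseteq> ?A"
    by (auto elim!: parcs_treeE)
  ultimately show "?B \<subseteq> ?A" by blast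
qed

lemma generalized_action_graphs_tree:
  assumes s_pos: "\<And>n. s n > 0" and s: "\<And>n. s n = card (compositions_of z n)"
  shows "generalized_action_graphs s tree (\<lambda>n. label) (e [])"
proof (rule generalized_action_graphs.intro)
  show "s n > 0" for n by (rule s_pos)
  show "s 0 = 1" by (simp add: s compositions_of_0)
  show "out_tree (tree n) (e [])" for n by (rule out_tree_tree)
  have tree_0: "pverts (tree 0) = e ` compositions_of z 0"
    by (auto simp: compositions_of_def elim!: pverts_treeE)
  show "card (pverts (tree 0)) = s 0"
    by (simp add: tree_0 s card_image_e)
  \<comment> \<open>Labels do not depend on the step, so keeping them is a reflexive equation.\<close>
  show "label v = label v" for v by (rule refl)
  show "label v = 0" if "v \<in> pverts (tree 0)" for v
    using that by (auto elim: pverts_treeE)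
  show "parcs (tree 0) = {}"
    by (auto elim: parcs_treeE)
  show "pverts (tree n) \<subseteq> pverts (tree (Suc n))" for n
    by (auto elim: pverts_treeE)
  show "card (pverts (tree (Suc n)) - pverts (tree n)) = s (Suc n)" for n
    by (simp add: new_verts_tree s card_image_e)
  show "label v = Suc n" if "v \<in> pverts (tree (Suc n)) - pverts (tree n)" for v n
    using that unfolding new_verts_tree by (auto simp: compositions_of_def)
  have "e (tl (inv e v)) \<in> pverts (tree n)" if "v \<in> pverts (tree (Suc n)) - pverts (tree n)" for v n
  proof -
    from that obtain xs where "v = e xs" "xs \<in> compositions z" "weight xs = Suc n"
      by (auto simp: new_verts_tree compositions_of_def)
    then show ?thesis by (cases xs) auto
  qed
  then show "\<exists>parent. (\<forall>v \<in> pverts (tree (Suc n)) - pverts (tree n). parent v \<in> pverts (tree n)) \<and>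
      parcs (tree (Suc n)) =
        parcs (tree n) \<union> (\<lambda>v. (parent v, v)) ` (pverts (tree (Suc n)) - pverts (tree n))" for n
    using parcs_tree_Suc by (intro exI[of _ "\<lambda>v. e (tl (inv e v))"]) blast
  show "\<exists>k\<le>n. digraph_iso (subtree_at (tree n) v) (with_proj (tree k))"
    if "v \<in> pverts (tree n)" for v n
    using that by (elim pverts_treeE) (metis subtree_iso_tree diff_le_self)
  show "label v = n" if "v \<in> pverts (tree n)" "out_arcs (with_proj (tree n)) v = {}" for v n
    using that out_arcs_tree_nonempty by (elim pverts_treeE) (metis label_e le_neq_implies_less)
qed

lemma card_children_of_root:
  assumes "1 \<le> i" "i \<le> n"
  shows "card {v \<in> pverts (tree n). label v = i \<and> e [] \<rightarrow>\<^bsub>with_proj (tree n)\<^esub> v} = z i"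
proof -
  have "{v \<in> pverts (tree n). label v = i \<and> e [] \<rightarrow>\<^bsub>with_proj (tree n)\<^esub> v} =
      e ` (\<lambda>c. [(i, c)]) ` {..<z i}"
    using assms by (auto elim!: pverts_treeE)
  then show ?thesis
    by (simp add: card_image_e card_image inj_on_def)
qed

end

theorem theorem2p1:
  fixes s z :: "nat \<Rightarrow> nat"
  assumes s_pos: "\<And>n. s n > 0"
    and s_0: "s 0 = 1"
    and z_pos: "\<And>n. n \<ge> 1 \<Longrightarrow> z n > 0"
    and z_1: "z 1 = s 1"
    and s_rec: "\<And>n. n \<ge> 2 \<Longrightarrow> s n = z n + (\<Sum>i = 1..n - 1. z i * s (n - i))"
  shows "\<exists>(G :: nat \<Rightarrow> nat pair_pre_digraph) (label :: nat \<Rightarrow> nat \<Rightarrow> nat) (r :: nat).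
    generalized_action_graphs s G label r \<and>
    (\<forall>n i. 1 \<le> i \<and> i \<le> n \<longrightarrow>
      z i = card {v \<in> pverts (G n). label n v = i \<and> r \<rightarrow>\<^bsub>with_proj (G n)\<^esub> v})"
proof -
  interpret composition_tree z "to_nat :: (nat \<times> nat) list \<Rightarrow> nat"
    by unfold_locales (simp_all add: z_pos)
  have "s n = (\<Sum>i = 1..n. z i * s (n - i))" if "n \<ge> 1" for n
  proof (cases "n = 1")
    case True
    then show ?thesis using z_1 by (simp add: s_0)
  next
    case False
    with that have "n \<ge> 2" by simp
    then have "s n = z n + (\<Sum>i = 1..n - 1. z i * s (n - i))"
      by (rule s_rec)
    \<comment> \<open>The summand \<open>z n\<close> is the term for \<open>i = n\<close>, as \<open>s 0 = 1\<close>.\<close>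
    also have "\<dots> = (\<Sum>i = 1..Suc (n - 1). z i * s (n - i))"
      using that by (subst sum.cl_ivl_Suc) (simp add: s_0)
    finally show ?thesis
      using that by simp
  qed
  then have "s n = card (compositions_of z n)" for n
    using card_compositions_of[of s z] s_0 by simp
  then have "generalized_action_graphs s tree (\<lambda>n. label) (to_nat ([] :: (nat \<times> nat) list))"
    using s_pos by (intro generalized_action_graphs_tree)
  then show ?thesis
    by (intro exI conjI allI impI; (elim conjE)?)
      (assumption | rule card_children_of_root[symmetric])+
qed

end
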